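(* Let $\alpha\in(1,2]$ and $\gamma=\frac{\alpha}{\alpha-1}\ge2$. Let $k$ be a kernel (symmetric, integrable, non-trivial, nonnegative, $k(0)=0$) with finite $\alpha$-th moment, i.e. $\sum_{j\in\mathbb{N}}k(j)j^\alpha<\infty$. Assume further that $k$ is non-increasing on $\mathbb{N}$ and that there is a constant $C\ge1$ with $$k(j)\le C\,k(j+1),\qquad j\in\mathbb{N}.$$ Then there exists a finite $d>0$ such that for any $x\in\mathbb{Z}$ the operator $L$ generated by $k$ satisfies $$\Psi_{2,\Upsilon}(u)(x)\ \ge\ \frac1d\,\big|Lu(x)\big|^\gamma,\qquad u\in\ell^\infty(\mathbb{Z}).$$ In particular, $L$ satisfies $CD_\Upsilon(0,F)$ with the $CD$-function $F(r)=\frac1d r^\gamma$, $r\ge0$.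
   Context: Kernel and operator: $k:\mathbb{Z}\to[0,\infty)$ is not identically zero, $k(0)=0$, $k(j)=k(-j)$ for all $j$, and $|k|_1:=\sum_{j\in\mathbb{Z}}k(j)<\infty$. The operator generated by $k$ is $Lu(x)=\sum_{j\in\mathbb{Z}}k(j)\big(u(x+j)-u(x)\big)$, $x\in\mathbb{Z}$. $\ell^\infty(\mathbb{Z})$ denotes the bounded functions $\mathbb{Z}\to\mathbb{R}$; $\mathbb{N}=\{1,2,\dots\}$. Let $\Upsilon(r)=e^r-1-r$, $r\in\mathbb{R}$. For $u,v\in\ell^\infty(\mathbb{Z})$ put $\Psi_\Upsilon(u)(x)=\sum_{y\in\mathbb{Z}}k(x-y)\Upsilon(u(y)-u(x))$, $B_{\Upsilon'}(u,v)(x)=\sum_{y\in\mathbb{Z}}k(x-y)\Upsilon'(u(y)-u(x))(v(y)-v(x))$ and $\Psi_{2,\Upsilon}(u)(x)=\frac12\big(L\Psi_\Upsilon(u)(x)-B_{\Upsilon'}(u,Lu)(x)\big)$. A $CD$-function is a continuous $F:[0,\infty)\to[0,\infty)$ with $F(0)=0$, $r\mapsto F(r)/r$ strictly increasing on $(0,\infty)$, and $1/F$ integrable at $\infty$. $L$ satisfies $CD_\Upsilon(0,F)$ if for every $u\in\ell^\infty(\mathbb{Z})$ and every $x\in\mathbb{Z}$: $\Psi_{2,\Upsilon}(u)(x)\ge F(-Lu(x))$ whenever $-Lu(x)\ge 0$ (and $\Psi_{2,\Upsilon}(u)(x)\ge 0$ otherwise). *)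

theory Defs
  imports "HOL-Analysis.Analysis"
begin

(* For a kernel and bounded functions, all infinite sums below converge absolutely,
   so the default value 0 of infsum for non-summable families is never used. *)

definition jump_kernel :: "(int \<Rightarrow> real) \<Rightarrow> bool" where
  "jump_kernel k \<longleftrightarrow> (\<forall>j. 0 \<le> k j) \<and> (\<exists>j. k j \<noteq> 0) \<and> k 0 = 0 \<and>
     (\<forall>j. k j = k (- j)) \<and> k summable_on UNIV"

definition linfty :: "(int \<Rightarrow> real) set" where
  "linfty = {u. bounded (range u)}"

definition L_op :: "(int \<Rightarrow> real) \<Rightarrow> (int \<Rightarrow> real) \<Rightarrow> int \<Rightarrow> real" where
  "L_op k u x = (\<Sum>\<^sub>\<infinity>j\<in>UNIV. k j * (u (x + j) - u x))"

definition Upsilon :: "real \<Rightarrow> real" where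
  "Upsilon r = exp r - 1 - r"

lemma deriv_Upsilon: "deriv Upsilon r = exp r - 1"
  unfolding Upsilon_def by (rule DERIV_imp_deriv) (auto intro!: derivative_eq_intros)

definition Psi :: "(int \<Rightarrow> real) \<Rightarrow> (real \<Rightarrow> real) \<Rightarrow> (int \<Rightarrow> real) \<Rightarrow> int \<Rightarrow> real" where
  "Psi k H u x = (\<Sum>\<^sub>\<infinity>y\<in>UNIV. k (x - y) * H (u y - u x))"

definition B_op :: "(int \<Rightarrow> real) \<Rightarrow> (real \<Rightarrow> real) \<Rightarrow> (int \<Rightarrow> real) \<Rightarrow> (int \<Rightarrow> real) \<Rightarrow> int \<Rightarrow> real" where
  "B_op k H u v x = (\<Sum>\<^sub>\<infinity>y\<in>UNIV. k (x - y) * H (u y - u x) * (v y - v x))"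

definition Psi2_Upsilon :: "(int \<Rightarrow> real) \<Rightarrow> (int \<Rightarrow> real) \<Rightarrow> int \<Rightarrow> real" where
  "Psi2_Upsilon k u x =
     1 / 2 * (L_op k (Psi k Upsilon u) x - B_op k (deriv Upsilon) u (L_op k u) x)"

(* A function on [0,\<infinity>) is represented by a total function on the reals;
   only its values on [0,\<infinity>) matter. *)
definition CD_function :: "(real \<Rightarrow> real) \<Rightarrow> bool" where
  "CD_function F \<longleftrightarrow> continuous_on {0..} F \<and> (\<forall>r\<ge>0. 0 \<le> F r) \<and> F 0 = 0 \<and>
     strict_mono_on {0<..} (\<lambda>r. F r / r) \<and>
     (\<exists>R>0. set_integrable lborel {R..} (\<lambda>r. 1 / F r))"

definition CD_Upsilon_0 :: "(int \<Rightarrow> real) \<Rightarrow> (real \<Rightarrow> real) \<Rightarrow> bool" where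
  "CD_Upsilon_0 k F \<longleftrightarrow> (\<forall>u\<in>linfty. \<forall>x.
     (if - L_op k u x \<ge> 0 then Psi2_Upsilon k u x \<ge> F (- L_op k u x)
      else Psi2_Upsilon k u x \<ge> 0))"

end

theory Submission
  imports Defs
begin

text \<open>
Fix \<open>x\<close> and put \<open>a j = u (x + j) - u x\<close>. Expanding \<open>\<Psi>\<^sub>2\<close> and symmetrising the double sum gives
\<open>2 \<Psi>\<^sub>2(u)(x) = \<Sum>\<^sub>j \<Sum>\<^sub>l k(j) k(l) exp (a j) \<Upsilon>(a (j + l) - a j - a l)\<close>
(\<open>Psi2_Upsilon_eq_kernel_sum2\<close>). All terms are nonnegative, so any of them may be discarded.

On the other side, \<open>L u x = \<Sum>\<^sub>j\<^sub>\<ge>\<^sub>1 k(j) z j\<close> with the second differences \<open>z j = a j + a (- j)\<close>. Keeping only the terms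
with \<open>l = - j\<close> would control \<open>\<Sum>\<^sub>j k(j)\<^sup>2 \<bar>z j\<bar>\<^sup>\<gamma>\<close>, which is too weak for kernels with heavy tails. Keeping
instead the terms with \<open>j = \<plusminus>1\<close> loses only one factor \<open>k(1)\<close> and controls the increments
\<open>b i = z i - z (i - 1)\<close>: \<open>\<Sum>\<^sub>i k(i) \<bar>b i\<bar>\<^sup>\<gamma> \<le> K \<Psi>\<^sub>2(u)(x)\<close> (\<open>sum_second_differences_le\<close>). The exponential weights
\<open>exp (a 1)\<close> and \<open>exp (a (- 1))\<close>, either of which may be arbitrarily small, are the difficulty here. It is resolved by an
elementary inequality for \<open>\<Upsilon>\<close> (\<open>Upsilon_reflected\<close>): each deviation \<open>D\<close> occurs with one weight as \<open>\<Upsilon>(D)\<close> and with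
the other weight as \<open>\<Upsilon>(- D - z 1)\<close>, so the arithmetic-geometric mean inequality leaves only the weight
\<open>exp (z 1 / 2)\<close>, and \<open>z 1\<close> is itself controlled.

Since \<open>\<bar>z j\<bar> \<le> \<Sum>\<^sub>i\<^sub>\<le>\<^sub>j \<bar>b i\<bar>\<close>, a Hardy inequality for the decreasing weight \<open>k\<close>
(\<open>discrete_Hardy\<close>) bounds \<open>\<bar>\<Sum>\<^sub>j k(j) z j\<bar>\<^sup>\<gamma>\<close> by \<open>\<Sum>\<^sub>i k(i) \<bar>b i\<bar>\<^sup>\<gamma>\<close> times a power of the
\<open>\<alpha>\<close>-th moment; the exponent \<open>\<gamma>\<close>, conjugate to \<open>\<alpha>\<close>, arises in this step.
\<close>

section \<open>Elementary inequalities for \<open>\<Upsilon>\<close>\<close>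

lemma Upsilon_ge_square: "(exp (y / 2) - 1)\<^sup>2 \<le> Upsilon y"
proof -
  have "exp y = (exp (y / 2))\<^sup>2" by (simp flip: exp_double)
  moreover have "1 + y / 2 \<le> exp (y / 2)" by (rule exp_ge_add_one_self)
  ultimately show ?thesis unfolding Upsilon_def power2_diff one_power2 mult_1_right by linarith
qed

lemma Upsilon_nonneg: "0 \<le> Upsilon y"
  using order_trans[OF zero_le_power2 Upsilon_ge_square] .

lemma exp_dominates_powr:
  fixes \<beta> \<eta> :: real
  assumes "0 < \<beta>" "0 < \<eta>"
  obtains c where "0 < c" "\<And>t. 0 \<le> t \<Longrightarrow> c * (1 + t) powr \<beta> \<le> exp (\<eta> * t)"
proof
  define m where "m = min 1 (\<eta> / \<beta>)"
  have m: "0 < m" "m \<le> 1" "m \<le> \<eta> / \<beta>" using assms by (auto simp: m_def)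
  show "0 < m powr \<beta>" using m by simp
  fix t :: real assume t: "0 \<le> t"
  have "m * t \<le> (\<eta> / \<beta>) * t" using m t by (intro mult_right_mono) auto
  with m have "m * (1 + t) \<le> 1 + \<eta> * t / \<beta>" by (simp add: algebra_simps)
  also have "\<dots> \<le> exp (\<eta> * t / \<beta>)" by (rule exp_ge_add_one_self)
  finally have "(m * (1 + t)) powr \<beta> \<le> exp (\<eta> * t / \<beta>) powr \<beta>"
    using m t assms by (intro powr_mono2) auto
  then show "m powr \<beta> * (1 + t) powr \<beta> \<le> exp (\<eta> * t)"
    using m t assms by (simp add: powr_mult exp_powr_real)
qed

lemma one_minus_exp_ge: "0 \<le> (x::real) \<Longrightarrow> x / (1 + x) \<le> 1 - exp (- x)"
  using exp_ge_add_one_self[of x] by (simp add: exp_minus field_simps)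

text \<open>The function \<open>e\<^sup>t\<^sup>/\<^sup>8 (t / (1 + t))\<^sup>2\<close> is a convenient common minorant for the two
cases of the next lemma: quadratic near \<open>0\<close> and exponential at infinity, so it dominates every power
\<open>t\<^sup>\<gamma>\<close> with \<open>\<gamma> \<ge> 2\<close> up to a constant.\<close>
lemma exp_diff_square_ge:
  fixes w t :: real
  assumes "0 \<le> t" "t / 16 \<le> \<bar>w\<bar>"
  shows "exp (t / 8) * (t / (1 + t))\<^sup>2 / 256 \<le> (exp w - exp (- w))\<^sup>2"
proof -
  have *: "exp (t / 16) * (t / (1 + t) / 16) \<le> exp v - exp (- v)" if "t / 16 \<le> v" for v
  proof -
    have "t / (1 + t) / 16 \<le> (t / 16) / (1 + t / 16)" using assms by (simp add: field_simps)
    also have "\<dots> \<le> 1 - exp (- (t / 16))" using assms by (intro one_minus_exp_ge) auto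
    also have "\<dots> \<le> 1 - exp (- v - t / 16)" using assms that by simp
    finally have "exp (t / 16) * (t / (1 + t) / 16) \<le> exp (t / 16) * (1 - exp (- v - t / 16))"
      by (intro mult_left_mono) auto
    also have "\<dots> = exp (t/16) - exp (- v)" by (simp add: right_diff_distrib flip: exp_add)
    also have "\<dots> \<le> exp v - exp (- v)" using that by simp
    finally show ?thesis .
  qed
  have "exp (t / 16) * (t / (1 + t) / 16) \<le> \<bar>exp w - exp (- w)\<bar>"
    using *[of w] *[of "- w"] assms by (cases "w \<ge> 0") auto
  then have "(exp (t / 16) * (t / (1 + t) / 16))\<^sup>2 \<le> (exp w - exp (- w))\<^sup>2"
    using assms by (intro abs_le_square_iff[THEN iffD1]) simp
  then show ?thesis
    by (simp only: power_mult_distrib[of "exp _"] power_divide[of "t / (1 + t)"] flip: exp_double) simp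
qed

text \<open>Since \<open>\<Upsilon>\<close> grows only linearly at \<open>-\<infinity>\<close> and either of the weights \<open>e\<^sup>p\<close>, \<open>e\<^sup>q\<close> may be tiny, no single
summand controls \<open>D\<close>. The two arguments \<open>D\<close> and \<open>- D - z\<close> are however nearly opposite, so
the arithmetic-geometric mean inequality replaces the two weights by the single factor \<open>e\<^sup>z\<^sup>/\<^sup>2\<close> and pairs
an exponentially large value of \<open>\<Upsilon>\<close> with a linear one. The factor \<open>e\<^sup>z\<^sup>/\<^sup>2\<close> is harmless as long as
\<open>\<bar>z\<bar> \<le> \<bar>D\<bar> / 4\<close>; for larger \<open>\<bar>z\<bar>\<close> the last summand alone suffices, again by the mean inequality.\<close>
lemma Upsilon_reflected:
  fixes p q D :: real
  defines "z \<equiv> p + q"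
  shows "exp (\<bar>D\<bar> / 8) * (\<bar>D\<bar> / (1 + \<bar>D\<bar>))\<^sup>2 / 256
    \<le> exp p * Upsilon D + exp q * Upsilon (- D - z) + (exp p + exp q) * Upsilon (- z)"
    (is "?lhs \<le> ?P + ?Q + ?R")
proof -
  have amgm: "exp (z / 2) * (\<bar>a\<bar> * \<bar>b\<bar>) \<le> exp p * a\<^sup>2 + exp q * b\<^sup>2" for a b :: real
  proof -
    define P Q where "P = exp (p / 2) * \<bar>a\<bar>" and "Q = exp (q / 2) * \<bar>b\<bar>"
    have "0 \<le> P * Q" "0 \<le> (P - Q)\<^sup>2" by (auto simp: P_def Q_def)
    then have "P * Q \<le> P\<^sup>2 + Q\<^sup>2" unfolding power2_diff by linarith
    moreover have "P * Q = exp (z / 2) * (\<bar>a\<bar> * \<bar>b\<bar>)"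
      by (simp add: P_def Q_def z_def add_divide_distrib exp_add)
    moreover have "P\<^sup>2 = exp p * a\<^sup>2" "Q\<^sup>2 = exp q * b\<^sup>2"
      by (simp_all add: P_def Q_def power_mult_distrib flip: exp_double)
    ultimately show ?thesis by simp
  qed
  have pos: "0 \<le> ?P" "0 \<le> ?Q" "0 \<le> ?R"
    by (simp_all add: Upsilon_nonneg)
  show ?thesis
  proof (cases "\<bar>D\<bar> / 4 \<le> \<bar>z\<bar>")
    case True
    have "?lhs \<le> (exp (z / 4) - exp (- (z / 4)))\<^sup>2"
      using True by (intro exp_diff_square_ge) auto
    also have "\<dots> = exp (z / 2) * (exp (- z / 2) - 1)\<^sup>2"
      by (simp add: power2_eq_square algebra_simps flip: exp_add)
    also have "\<dots> = exp (z / 2) * (\<bar>exp (- z / 2) - 1\<bar> * \<bar>exp (- z / 2) - 1\<bar>)"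
      by (simp add: power2_eq_square flip: abs_mult)
    also have "\<dots> \<le> exp p * (exp (- z / 2) - 1)\<^sup>2 + exp q * (exp (- z / 2) - 1)\<^sup>2"
      by (rule amgm)
    also have "\<dots> \<le> ?R"
      using mult_left_mono[OF Upsilon_ge_square[of "- z"], of "exp p + exp q"] by (simp add: algebra_simps)
    finally show ?thesis using pos by linarith
  next
    case False
    define t where "t = \<bar>D\<bar>"
    have t: "0 \<le> t" "\<bar>z\<bar> \<le> t / 4" using False by (auto simp: t_def)
    \<comment> \<open>The right-hand side is the geometric mean in the worst case \<open>D = t\<close>, \<open>z = - t / 4\<close>.\<close>
    have lower: "exp (t / 8) * (t / (1 + t))\<^sup>2 / 256 \<le> exp (- t / 8) * (exp (t / 2) - 1) * (1 - exp (- 3 * t / 8))"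
    proof -
      have "t / (1 + t) / 4 \<le> t / 4" using t by (simp add: field_simps)
      also have "\<dots> \<le> exp (t / 4) - exp (- (t / 4))"
        using exp_ge_add_one_self[of "t / 4"] t by (smt (verit) exp_le_one_iff divide_nonneg_pos)
      finally have "exp (t / 4) * (t / (1 + t) / 4) \<le> exp (t / 4) * (exp (t / 4) - exp (- (t / 4)))"
        by (intro mult_left_mono) auto
      also have "\<dots> = exp (t / 2) - 1" by (simp add: right_diff_distrib flip: exp_add)
      finally have 1: "exp (t / 4) * (t / (1 + t) / 4) \<le> exp (t / 2) - 1" .
      have "t / (1 + t) / 4 \<le> (3 * t / 8) / (1 + 3 * t / 8)" using t by (simp add: field_simps)
      also have "\<dots> \<le> 1 - exp (- 3 * t / 8)" using one_minus_exp_ge[of "3 * t / 8"] t by simp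
      finally have 2: "t / (1 + t) / 4 \<le> 1 - exp (- 3 * t / 8)" .
      have "exp (t / 8) * (t / (1 + t))\<^sup>2 / 256 \<le> exp (t / 8) * (t / (1 + t))\<^sup>2 / 16"
        using t by (intro divide_left_mono mult_nonneg_nonneg) auto
      also have "\<dots> = exp (- t / 8) * ((exp (t / 4) * (t / (1 + t) / 4)) * (t / (1 + t) / 4))"
      proof -
        have *: "exp (t / 8) = exp (- t / 8) * exp (t / 4)" by (simp flip: exp_add)
        have "e * e' * r\<^sup>2 / 16 = e * (e' * (r / 4) * (r / 4))" for e e' r :: real
          by (simp add: power2_eq_square)
        then show ?thesis unfolding * .
      qed
      also have "\<dots> \<le> exp (- t / 8) * ((exp (t / 2) - 1) * (1 - exp (- 3 * t / 8)))"
        using 1 2 t by (intro mult_left_mono mult_mono) auto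
      finally show ?thesis by (simp add: mult.assoc)
    qed
    have "exp (- t / 8) * (exp (t / 2) - 1) * (1 - exp (- 3 * t / 8)) \<le>
       exp (z / 2) * (\<bar>exp (D / 2) - 1\<bar> * \<bar>exp ((- D - z) / 2) - 1\<bar>)"
    proof (cases "0 \<le> D")
      case True
      then have D: "D = t" by (simp add: t_def)
      have "exp (- t / 8) * (exp (t / 2) - 1) * (1 - exp (- 3 * t / 8))
          = (exp (t / 2) - 1) * (exp (- t / 8) - exp (- t / 2))"
        by (simp add: algebra_simps flip: exp_add)
      also have "\<dots> \<le> (exp (t / 2) - 1) * (exp (z / 2) - exp (- t / 2))"
        using t by (intro mult_left_mono diff_mono) auto
      also have "\<dots> = exp (z / 2) * ((exp (t / 2) - 1) * (1 - exp ((- t - z) / 2)))"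
        by (simp add: algebra_simps diff_divide_distrib add_divide_distrib flip: exp_add)
      finally show ?thesis using t by (simp add: D)
    next
      case False
      then have D: "D = - t" by (simp add: t_def)
      have "exp (- t / 8) * ((exp (t / 2) - 1) * (1 - exp (- 3 * t / 8))) 
        \<le> 1 * ((exp (t / 2) - 1) * (1 - exp (- 3 * t / 8)))"
        using t by (intro mult_right_mono) auto
      also have "\<dots> = (1 - exp (- t / 2)) * (exp (t / 2) - exp (t / 8))"
        by (simp add: algebra_simps flip: exp_add)
      also have "\<dots> \<le> (1 - exp (- t / 2)) * (exp (t / 2) - exp (z / 2))"
        using t by (intro mult_left_mono diff_mono) auto
      also have "\<dots> = exp (z / 2) * ((1 - exp (- t / 2)) * (exp ((t - z) / 2) - 1))"
        by (simp add: algebra_simps diff_divide_distrib add_divide_distrib flip: exp_add)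
      finally show ?thesis using t by (simp add: D mult.assoc)
    qed
    also have "\<dots> \<le> exp p * (exp (D / 2) - 1)\<^sup>2 + exp q * (exp ((- D - z) / 2) - 1)\<^sup>2"
      by (rule amgm)
    also have "\<dots> \<le> ?P + ?Q"
      by (intro add_mono mult_left_mono Upsilon_ge_square) auto
    finally show ?thesis using pos lower by (simp add: t_def)
  qed
qed


lemma Upsilon_reflected_powr:
  fixes \<gamma> :: real
  assumes "2 \<le> \<gamma>"
  obtains K where "0 < K" "\<And>p q D. \<bar>D\<bar> powr \<gamma> \<le>
    K * (exp p * Upsilon D + exp q * Upsilon (- D - (p + q)) + (exp p + exp q) * Upsilon (- (p + q)))"
proof -
  obtain c where c: "0 < c" "\<And>t. 0 \<le> t \<Longrightarrow> c * (1 + t) powr \<gamma> \<le> exp (1 / 8 * t)"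
    using exp_dominates_powr[of \<gamma> "1 / 8"] assms by auto
  have lower: "c * t powr \<gamma> \<le> exp (t / 8) * (t / (1 + t))\<^sup>2" if "0 \<le> t" for t
  proof -
    have "t powr \<gamma> = t powr (\<gamma> - 2) * t\<^sup>2"
      using that powr_add[of t "\<gamma> - 2" 2] by (cases "t = 0") auto
    also have "\<dots> \<le> (1 + t) powr (\<gamma> - 2) * t\<^sup>2"
      using that assms by (intro mult_right_mono powr_mono2) auto
    also have "(1 + t) powr (\<gamma> - 2) = (1 + t) powr \<gamma> / (1 + t)\<^sup>2"
      using that by (simp add: powr_diff)
    finally have "c * t powr \<gamma> \<le> c * ((1 + t) powr \<gamma> / (1 + t)\<^sup>2 * t\<^sup>2)"
      using c by (intro mult_left_mono) auto
    also have "\<dots> = c * (1 + t) powr \<gamma> * (t / (1 + t))\<^sup>2"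
      by (simp add: power_divide)
    also have "\<dots> \<le> exp (t / 8) * (t / (1 + t))\<^sup>2"
      using c(2)[OF that] by (intro mult_right_mono) auto
    finally show ?thesis .
  qed
  show thesis
  proof
    show "0 < 256 / c" using c by simp
    fix p q D :: real
    let ?E = "exp p * Upsilon D + exp q * Upsilon (- D - (p + q)) + (exp p + exp q) * Upsilon (- (p + q))"
    have "c * \<bar>D\<bar> powr \<gamma> \<le> 256 * ?E"
      using order_trans[OF lower[OF abs_ge_zero, of D]] Upsilon_reflected[of D p q] by simp
    then show "\<bar>D\<bar> powr \<gamma> \<le> 256 / c * ?E"
      using c by (simp only: times_divide_eq_left pos_le_divide_eq mult.commute[of c])
  qed
qed

section \<open>A discrete Hardy inequality\<close>

text \<open>Jensen's inequality for the probability weights \<open>m i / (\<Sum>i\<in>I. m i)\<close>; it plays the role of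
Hoelder's inequality in the proof of Hardy's inequality.\<close>
lemma power_mean_weighted:
  fixes m y :: "'a \<Rightarrow> real"
  assumes "finite I" "\<And>i. i \<in> I \<Longrightarrow> 0 \<le> m i" "\<And>i. i \<in> I \<Longrightarrow> 0 \<le> y i" "1 \<le> \<gamma>"
  shows "(\<Sum>i\<in>I. m i * y i) powr \<gamma> \<le> (\<Sum>i\<in>I. m i) powr (\<gamma> - 1) * (\<Sum>i\<in>I. m i * y i powr \<gamma>)"
proof -
  \<comment> \<open>Jensen's inequality is applied on the open half-line, so vanishing terms are dropped first.\<close>
  define J where "J = {i \<in> I. 0 < m i * y i}"
  have J: "finite J" "J \<subseteq> I" using assms by (auto simp: J_def)
  have Jpos: "0 < m i" "0 < y i" if "i \<in> J" for i
    using that assms by (auto simp: J_def zero_less_mult_iff dest!: assms(2,3)) 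
  have restrict: "(\<Sum>i\<in>I. m i * y i) = (\<Sum>i\<in>J. m i * y i)"
    using assms J by (intro sum.mono_neutral_right) (auto simp: J_def less_le)
  have rhs: "(\<Sum>i\<in>J. m i) powr (\<gamma> - 1) * (\<Sum>i\<in>J. m i * y i powr \<gamma>)
     \<le> (\<Sum>i\<in>I. m i) powr (\<gamma> - 1) * (\<Sum>i\<in>I. m i * y i powr \<gamma>)"
    using assms J by (intro mult_mono powr_mono2 sum_mono2 sum_nonneg) (auto intro!: sum_nonneg mult_nonneg_nonneg)
  show ?thesis
  proof (cases "J = {}")
    case True
    then show ?thesis using rhs by (simp add: restrict)
  next
    case False
    define M where "M = (\<Sum>i\<in>J. m i)"
    have M: "0 < M" unfolding M_def using J False Jpos by (intro sum_pos) auto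
    have "(\<Sum>i\<in>J. (m i / M) *\<^sub>R y i) powr \<gamma> \<le> (\<Sum>i\<in>J. m i / M * y i powr \<gamma>)"
      using J False Jpos M assms
      by (intro convex_on_sum[OF _ _ powr_convex[of \<gamma>]]) (auto simp: M_def less_imp_le simp flip: sum_divide_distrib)
    then have "((\<Sum>i\<in>J. m i * y i) / M) powr \<gamma> \<le> (\<Sum>i\<in>J. m i * y i powr \<gamma>) / M"
      by (simp add: sum_divide_distrib)
    then have "(\<Sum>i\<in>J. m i * y i) powr \<gamma> / M powr \<gamma> \<le> (\<Sum>i\<in>J. m i * y i powr \<gamma>) / M"
      using M Jpos by (subst (asm) powr_divide) (auto intro!: sum_nonneg simp: less_imp_le)
    then have "(\<Sum>i\<in>J. m i * y i) powr \<gamma> \<le> M powr (\<gamma> - 1) * (\<Sum>i\<in>J. m i * y i powr \<gamma>)"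
      using M by (simp add: powr_diff field_simps)
    then show ?thesis using rhs by (simp add: restrict M_def)
  qed
qed

lemma sum_inverse_sqrt_le: "(\<Sum>i=1..n. 1 / sqrt (real i)) \<le> 2 * sqrt (real n)"
proof (induction n)
  case (Suc n)
  define a b where "a = sqrt (real n)" and "b = sqrt (real (Suc n))"
  have ab: "0 < b" "a \<le> b" "b\<^sup>2 - a\<^sup>2 = 1" by (auto simp: a_def b_def)
  have "1 = (b - a) * (a + b)" using ab by (simp add: algebra_simps power2_eq_square)
  also have "\<dots> \<le> (b - a) * (2 * b)" using ab by (intro mult_left_mono) auto
  finally have "1 / b \<le> 2 * b - 2 * a" using ab by (simp add: field_simps)
  then show ?case using Suc by (simp add: a_def b_def)
qed simp

lemma sum_tail_three_halves_le:
  assumes "1 \<le> i" 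
  shows "(\<Sum>j=i..n. 1 / (real j * sqrt (real j))) \<le> 3 / sqrt (real i)"
proof (cases "i \<le> n")
  case True
  have "(\<Sum>j=i..n. 1 / (real j * sqrt (real j))) \<le> 3 / sqrt (real i) - 2 / sqrt (real n)"
    using True
  proof (induction n rule: dec_induct)
    case base
    have "1 / (real i * sqrt (real i)) \<le> 1 / sqrt (real i)"
      using assms by (intro divide_left_mono) auto
    then show ?case by simp
  next
    case (step n)
    define a b where "a = sqrt (real n)" and "b = sqrt (real (Suc n))"
    have ab: "0 < a" "a \<le> b" "b\<^sup>2 - a\<^sup>2 = 1" "real (Suc n) = b\<^sup>2" using step assms by (auto simp: a_def b_def)
    have "a * (a + b) \<le> 2 * b\<^sup>2"  using ab mult_mono[of a b "a+b" "2*b"] by (simp add: power2_eq_square)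
    moreover have "(b - a) * (a + b) = 1" using ab by (simp add: algebra_simps power2_eq_square)
    ultimately have "a  \<le> 2 * b\<^sup>2 * (b - a)"
      using ab mult_right_mono[of "a * (a+b)" "2 * b\<^sup>2" "b - a"] by (simp add: algebra_simps)
    then have "a / (a * (b\<^sup>2 * b)) \<le> 2 * b\<^sup>2 * (b - a) / (a * (b\<^sup>2 * b))"
      using ab by (intro divide_right_mono) auto
    also have "\<dots> = 2 / a - 2 / b"
      using ab(1,2) by (simp add: field_simps)
    finally have "1 / (b\<^sup>2 * b) \<le> 2 / a - 2 / b" using ab by simp
    then show ?case using step ab by (simp add: a_def b_def)
  qed
  also have "\<dots> \<le> 3 / sqrt (real i)" by simp
  finally show ?thesis .
qed simp

text \<open>Up to the moment factor, this is Hardy's inequality: for a decreasing weight \<open>\<kappa>\<close>, the weighted \<open>\<gamma>\<close>-norm of the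
averages of \<open>b\<close> is at most a constant times that of \<open>b\<close>. Writing the left-hand side as a sum over pairs \<open>i \<le> j\<close>, the power mean
inequality is applied with masses \<open>m (j, i) = \<kappa> j r\<^sup>\<alpha>\<^sup>-\<^sup>1\<close>, where \<open>r = j\<^sup>3\<^sup>/\<^sup>2 i\<^sup>-\<^sup>1\<^sup>/\<^sup>2\<close>. As
\<open>(\<alpha> - 1) (\<gamma> - 1) = 1\<close>, the powers of \<open>r\<close> on the right collapse to \<open>1 / r\<close>. The exponents of \<open>r\<close> are chosen so that
summing \<open>1 / r\<close> over \<open>j \<ge> i\<close> gives at most a constant, while summing \<open>r\<^sup>\<alpha>\<^sup>-\<^sup>1\<close> over \<open>i \<le> j\<close> costs a multiple of \<open>j\<^sup>\<alpha>\<close>,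
that is, the moment of the kernel.\<close>
lemma discrete_Hardy:
  fixes \<kappa> b :: "nat \<Rightarrow> real" and \<alpha> \<gamma> :: real
  assumes \<alpha>: "1 < \<alpha>" "\<alpha> \<le> 2" and \<gamma>: "\<gamma> = \<alpha> / (\<alpha> - 1)"
    and nonneg: "\<And>i. 0 \<le> \<kappa> i" "\<And>i. 0 \<le> b i"
    and decr: "\<And>i j. 1 \<le> i \<Longrightarrow> i \<le> j \<Longrightarrow> \<kappa> j \<le> \<kappa> i"
  shows "(\<Sum>j=1..N. \<kappa> j * (\<Sum>i=1..j. b i)) powr \<gamma>
    \<le> (2 * (\<Sum>j=1..N. \<kappa> j * real j powr \<alpha>)) powr (\<gamma> - 1) * (3 * (\<Sum>i=1..N. \<kappa> i * b i powr \<gamma>))"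
proof -
  define I where "I = Sigma {1..N} (\<lambda>j. {1..j})"
  define r where "r = (\<lambda>j i::nat. real j * sqrt (real j) / sqrt (real i))"
  define m where "m = (\<lambda>(j, i). \<kappa> j * r j i powr (\<alpha> - 1))"
  define y where "y = (\<lambda>(j, i). b i / r j i powr (\<alpha> - 1))"
  have \<gamma>1: "1 \<le> \<gamma>" "(\<alpha> - 1) * (\<gamma> - 1) = 1" using \<alpha> by (auto simp: \<gamma> field_simps)
  have I: "finite I" "\<And>j i. (j, i) \<in> I \<longleftrightarrow> 1 \<le> i \<and> i \<le> j \<and> j \<le> N" by (auto simp: I_def)
  have r_pos: "0 < r j i" if "(j, i) \<in> I" for j i using that I by (auto simp: r_def)
  have r_bound: "r j i powr (\<alpha> - 1) \<le> real j powr (\<alpha> - 2) * r j i" if "(j, i) \<in> I" for j i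
  proof -
    have "real j \<le> r j i" using that I by (auto simp: r_def field_simps)
    then have "r j i powr (\<alpha> - 2) \<le> real j powr (\<alpha> - 2)"
      using that I \<alpha> by (intro powr_mono2') auto
    then have "r j i powr (\<alpha> - 2) * r j i \<le> real j powr (\<alpha> - 2) * r j i"
      using r_pos[OF that] by simp
    moreover have "r j i powr (\<alpha> - 1) = r j i powr (\<alpha> - 2) * r j i"
      using r_pos[OF that] powr_add[of "r j i" "\<alpha> - 2" 1] by simp
    ultimately show ?thesis by simp
  qed
  have mass: "(\<Sum>c\<in>I. m c) \<le> 2 * (\<Sum>j=1..N. \<kappa> j * real j powr \<alpha>)"
  proof -
    have "(\<Sum>c\<in>I. m c) \<le> (\<Sum>(j, i)\<in>I. \<kappa> j * (real j powr (\<alpha> - 2) * r j i))"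
      unfolding m_def using nonneg r_bound by (intro sum_mono) (auto intro!: mult_left_mono)
    also have "\<dots> = (\<Sum>j=1..N. \<kappa> j * real j powr (\<alpha> - 2) * (real j * sqrt (real j)) * (\<Sum>i=1..j. 1 / sqrt (real i)))"
      unfolding I_def by (subst sum.Sigma[symmetric]) (auto simp: r_def sum_distrib_left mult.assoc intro!: sum.cong)
    also have "\<dots> \<le> (\<Sum>j=1..N. \<kappa> j * real j powr (\<alpha> - 2) * (real j * sqrt (real j)) * (2 * sqrt (real j)))"
      using nonneg by (intro sum_mono mult_left_mono sum_inverse_sqrt_le) auto
    also have "\<dots> = 2 * (\<Sum>j=1..N. \<kappa> j * real j powr \<alpha>)"
    proof -
      have "real j powr \<alpha> = real j powr (\<alpha> - 2) * (real j * real j)" if "1 \<le> j" for j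
        using that powr_add[of "real j" "\<alpha> - 2" 2] by (simp add: power2_eq_square)
      then show ?thesis
        unfolding sum_distrib_left by (intro sum.cong refl) (simp add: mult.assoc)
    qed
    finally show ?thesis .
  qed
  have energy: "(\<Sum>c\<in>I. m c * y c powr \<gamma>) \<le> 3 * (\<Sum>i=1..N. \<kappa> i * b i powr \<gamma>)"
  proof -
    have *: "m (j, i) * y (j, i) powr \<gamma> \<le> \<kappa> i * b i powr \<gamma> * sqrt (real i) * (1 / (real j * sqrt (real j)))"
      if "(j, i) \<in> I" for j i
    proof -
      have "y (j, i) powr \<gamma> = b i powr \<gamma> / r j i powr ((\<alpha> - 1) * \<gamma>)"
        unfolding y_def using nonneg by (simp add: powr_divide powr_powr)
      moreover have "r j i powr ((\<alpha> - 1) * \<gamma>) = r j i * r j i powr (\<alpha> - 1)"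
        using \<gamma>1 r_pos[OF that] powr_add[of "r j i" 1 "\<alpha> - 1"] by (simp add: algebra_simps)
      ultimately have "m (j, i) * y (j, i) powr \<gamma> = \<kappa> j * b i powr \<gamma> * (1 / r j i)"
        using r_pos[OF that] by (simp add: m_def)
      also have "\<dots> \<le> \<kappa> i * b i powr \<gamma> * (1 / r j i)"
        using that I r_pos[OF that] decr by (intro mult_right_mono) auto
      finally show ?thesis by (simp add: r_def)
    qed
    have "(\<Sum>c\<in>I. m c * y c powr \<gamma>) \<le> (\<Sum>(j, i)\<in>I. \<kappa> i * b i powr \<gamma> * sqrt (real i) * (1 / (real j * sqrt (real j))))"
      using * by (intro sum_mono) auto
    also have "\<dots> = (\<Sum>(i, j)\<in>Sigma {1..N} (\<lambda>i. {i..N}). \<kappa> i * b i powr \<gamma> * sqrt (real i) * (1 / (real j * sqrt (real j))))"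
      by (rule sum.reindex_bij_witness[of _ prod.swap prod.swap]) (auto simp: I_def)
    also have "\<dots> = (\<Sum>i=1..N. \<kappa> i * b i powr \<gamma> * sqrt (real i) * (\<Sum>j=i..N. 1 / (real j * sqrt (real j))))"
      by (subst sum.Sigma[symmetric]) (auto simp: sum_distrib_left)
    also have "\<dots> \<le> (\<Sum>i=1..N. \<kappa> i * b i powr \<gamma> * sqrt (real i) * (3 / sqrt (real i)))"
      using nonneg by (intro sum_mono mult_left_mono sum_tail_three_halves_le) auto
    also have "\<dots> = 3 * (\<Sum>i=1..N. \<kappa> i * b i powr \<gamma>)"
      unfolding sum_distrib_left by (intro sum.cong) auto
    finally show ?thesis .
  qed
  have "(\<Sum>j=1..N. \<kappa> j * (\<Sum>i=1..j. b i)) = (\<Sum>(j, i)\<in>I. \<kappa> j * b i)"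
    unfolding I_def by (subst sum.Sigma[symmetric]) (auto simp: sum_distrib_left)
  also have "\<dots> = (\<Sum>c\<in>I. m c * y c)"
    using r_pos by (intro sum.cong refl) (fastforce simp: m_def y_def)
  also have "\<dots> powr \<gamma> \<le> (\<Sum>c\<in>I. m c) powr (\<gamma> - 1) * (\<Sum>c\<in>I. m c * y c powr \<gamma>)"
    using I \<gamma>1 nonneg by (intro power_mean_weighted) (auto simp: m_def y_def)
  also have "\<dots> \<le> (2 * (\<Sum>j=1..N. \<kappa> j * real j powr \<alpha>)) powr (\<gamma> - 1) * (3 * (\<Sum>i=1..N. \<kappa> i * b i powr \<gamma>))"
    using \<gamma>1 nonneg by (intro mult_mono powr_mono2 mass energy) (auto intro!: sum_nonneg simp: m_def)
  finally show ?thesis .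
qed

section \<open>The double sum representation of \<open>\<Psi>\<^sub>2\<close>\<close>

definition kernel_sum2 :: "(int \<Rightarrow> real) \<Rightarrow> (int \<Rightarrow> int \<Rightarrow> real) \<Rightarrow> real" where
  "kernel_sum2 k f = (\<Sum>\<^sub>\<infinity>j. k j * (\<Sum>\<^sub>\<infinity>l. k l * f j l))"

definition bounded2 :: "(int \<Rightarrow> int \<Rightarrow> real) \<Rightarrow> bool" where
  "bounded2 f \<longleftrightarrow> bounded (range (case_prod f))"

text \<open>Every integrand in the expansion of \<open>\<Psi>\<^sub>2\<close> is a continuous expression in the increments of a bounded function at
\<open>j\<close>, \<open>l\<close> and \<open>j + l\<close>; this provides the boundedness needed to rearrange the double sums.\<close>
lemma bounded2_continuous:
  fixes \<Phi> :: "real \<times> real \<times> real \<Rightarrow> real"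
  assumes "bounded (range a)" "continuous_on UNIV \<Phi>"
  shows "bounded2 (\<lambda>j l. \<Phi> (a j, a l, a (j + l)))"
proof -
  define S where "S = closure (range a) \<times> closure (range a) \<times> closure (range a)"
  have "compact S" unfolding S_def using assms by (intro compact_Times) (simp_all add: compact_closure)
  then have "bounded (\<Phi> ` S)"
    using assms continuous_on_subset by (intro compact_imp_bounded compact_continuous_image) blast+
  moreover have "range (\<lambda>(j, l). \<Phi> (a j, a l, a (j + l))) \<subseteq> \<Phi> ` S"
    using closure_subset[of "range a"] by (auto simp: S_def)
  ultimately show ?thesis unfolding bounded2_def by (rule bounded_subset)
qed

lemma summable_kernel:
  assumes k: "jump_kernel k" and f: "bounded2 f"
  shows "(\<lambda>(j, l). k j * (k l * f j l)) summable_on UNIV \<times> UNIV"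
    and "(\<lambda>l. k l * f j l) summable_on UNIV"
    and "(\<lambda>j. k j * (\<Sum>\<^sub>\<infinity>l. k l * f j l)) summable_on UNIV"
proof -
  have nonneg: "0 \<le> k j" for j
    using k by (auto simp: jump_kernel_def)
  have summable: "k summable_on UNIV"
    using k by (auto simp: jump_kernel_def)
  obtain M where M: "\<bar>f j l\<bar> \<le> M" for j l
    using f unfolding bounded2_def bounded_iff by auto
  have "(\<lambda>c. case c of (j, l) \<Rightarrow> k j * (k l * M)) summable_on UNIV \<times> UNIV"
  proof (rule summable_on_SigmaI)
    fix j
    show "((\<lambda>l. case (j, l) of (j, l) \<Rightarrow> k j * (k l * M)) has_sum k j * ((\<Sum>\<^sub>\<infinity>l. k l) * M)) UNIV"
      using summable by (auto intro!: has_sum_cmult_left has_sum_cmult_right has_sum_infsum)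
  next
    show "(\<lambda>j. k j * ((\<Sum>\<^sub>\<infinity>l. k l) * M)) summable_on UNIV"
      using summable by (rule summable_on_cmult_left)
  next
    fix j l
    show "0 \<le> (case (j, l) of (j, l) \<Rightarrow> k j * (k l * M))"
      using nonneg order_trans[OF abs_ge_zero M] by simp
  qed
  then show *: "(\<lambda>(j, l). k j * (k l * f j l)) summable_on UNIV \<times> UNIV"
    by (rule Infinite_Sum.abs_summable_summable[OF Infinite_Sum.abs_summable_on_comparison_test'])
      (use M nonneg in \<open>auto simp: abs_mult intro!: mult_left_mono\<close>)
  have "(\<lambda>l. k l * M) summable_on UNIV" using summable by (rule summable_on_cmult_left)
  then show inner: "(\<lambda>l. k l * f j l) summable_on UNIV" for j
    by (rule Infinite_Sum.abs_summable_summable[OF Infinite_Sum.abs_summable_on_comparison_test'])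
      (use M nonneg in \<open>auto simp: abs_mult intro!: mult_left_mono\<close>)
  show "(\<lambda>j. k j * (\<Sum>\<^sub>\<infinity>l. k l * f j l)) summable_on UNIV"
    using summable_on_SigmaD[OF *] inner
    by (simp add: infsum_cmult_right summable_on_cmult_right)
qed

lemma kernel_sum2_swap:
  assumes k: "jump_kernel k" and f: "bounded2 f"
  shows "kernel_sum2 k (\<lambda>j l. f l j) = kernel_sum2 k f"
proof -
  have "kernel_sum2 k (\<lambda>j l. f l j) = (\<Sum>\<^sub>\<infinity>j. \<Sum>\<^sub>\<infinity>l. k j * (k l * f l j))"
    unfolding kernel_sum2_def by (simp add: infsum_cmult_right')
  also have "\<dots> = (\<Sum>\<^sub>\<infinity>j. \<Sum>\<^sub>\<infinity>l. k l * (k j * f l j))" by (simp add: ac_simps)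
  also have "\<dots> = (\<Sum>\<^sub>\<infinity>l. \<Sum>\<^sub>\<infinity>j. k l * (k j * f l j))"
    using summable_kernel(1)[OF k f] by (intro infsum_swap_banach[symmetric])
  also have "\<dots> = kernel_sum2 k f"
    unfolding kernel_sum2_def by (simp add: infsum_cmult_right')
  finally show ?thesis .
qed

lemma infsum_diff_real:
  fixes f g :: "'a \<Rightarrow> real"
  assumes "f summable_on A" "g summable_on A"
  shows "infsum (\<lambda>x. f x - g x) A = infsum f A - infsum g A"
  using infsum_add[of f A "\<lambda>x. - g x"] assms by (simp add: summable_on_uminus infsum_uminus)

lemma kernel_sum_diff:
  assumes k: "jump_kernel k" and f: "bounded2 f" and g: "bounded2 g"
  shows "(\<Sum>\<^sub>\<infinity>l. k l * f j l) - (\<Sum>\<^sub>\<infinity>l. k l * g j l) = (\<Sum>\<^sub>\<infinity>l. k l * (f j l - g j l))"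
  by (simp add: right_diff_distrib infsum_diff_real summable_kernel[OF k f] summable_kernel[OF k g])

lemma kernel_sum2_diff:
  assumes k: "jump_kernel k" and f: "bounded2 f" and g: "bounded2 g"
  shows "kernel_sum2 k f - kernel_sum2 k g = kernel_sum2 k (\<lambda>j l. f j l - g j l)"
  unfolding kernel_sum2_def kernel_sum_diff[OF k f g, symmetric]
  by (simp add: right_diff_distrib infsum_diff_real summable_kernel[OF k f] summable_kernel[OF k g])

text \<open>Expanding the definition with the increments \<open>a j = u (x + j) - u x\<close> and \<open>s = a (j + l) - a j - a l\<close> gives the
integrand \<open>exp (a l) * (exp s - 1) - exp (a j) * s\<close>. Because \<open>s\<close> is symmetric in \<open>j\<close> and \<open>l\<close>, exchanging the two
summation variables in the first half turns it into \<open>exp (a j) * Upsilon s\<close>, which is nonnegative.\<close>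
lemma Psi2_Upsilon_eq_kernel_sum2:
  assumes k: "jump_kernel k" and u: "u \<in> linfty"
  shows "bounded2 (\<lambda>j l. exp (u (x + j) - u x) * Upsilon (u (x + j + l) - u (x + j) - u (x + l) + u x))"
    and "2 * Psi2_Upsilon k u x = kernel_sum2 k
    (\<lambda>j l. exp (u (x + j) - u x) * Upsilon (u (x + j + l) - u (x + j) - u (x + l) + u x))"
proof -
  define a where "a j = u (x + j) - u x" for j
  have "bounded ((\<lambda>y. y - u x) ` range u)"
    using u unfolding linfty_def by (auto intro: bounded_translation_minus)
  then have a: "bounded (range a)" by (rule bounded_subset) (auto simp: a_def)
  have sym: "k (- l) = k l" for l using k by (auto simp: jump_kernel_def)
  have shift: "(\<Sum>\<^sub>\<infinity>y. k (v - y) * G y) = (\<Sum>\<^sub>\<infinity>l. k l * G (v + l))" for v G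
    by (subst infsum_reindex_bij_betw[of "\<lambda>l. v + l" UNIV UNIV, symmetric]) (auto simp: sym bij_plus_right)
  have bd: "bounded2 (\<lambda>j l. \<Phi> (a j) (a l) (a (j + l)))"
    if "continuous_on UNIV (\<lambda>c. \<Phi> (fst c) (fst (snd c)) (snd (snd c)))" for \<Phi>
    using bounded2_continuous[OF a that] by simp
  have contU: "continuous_on UNIV Upsilon"
    unfolding Upsilon_def[abs_def] by (intro continuous_intros)
  note contU' = continuous_on_compose2[OF contU]

  have LPsi: "L_op k (Psi k Upsilon u) x = kernel_sum2 k (\<lambda>j l. Upsilon (a (j + l) - a j) - Upsilon (a l))"
  proof -
    have "Psi k Upsilon u (x + j) = (\<Sum>\<^sub>\<infinity>l. k l * Upsilon (a (j + l) - a j))" for j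
      unfolding Psi_def a_def by (simp add: shift add.assoc)
    moreover have "Psi k Upsilon u x = (\<Sum>\<^sub>\<infinity>l. k l * Upsilon (a l))"
      unfolding Psi_def a_def by (simp add: shift)
    ultimately have "Psi k Upsilon u (x + j) - Psi k Upsilon u x =
       (\<Sum>\<^sub>\<infinity>l. k l * (Upsilon (a (j + l) - a j) - Upsilon (a l)))" for j
      by (simp only:) (intro kernel_sum_diff k bd; intro continuous_intros contU'; simp)
    then show ?thesis unfolding L_op_def kernel_sum2_def by simp
  qed
  have B: "B_op k (deriv Upsilon) u (L_op k u) x =
    kernel_sum2 k (\<lambda>j l. (exp (a j) - 1) * (a (j + l) - a j - a l))"
  proof -
    have "L_op k u (x + j) = (\<Sum>\<^sub>\<infinity>l. k l * (a (j + l) - a j))" for j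
      unfolding L_op_def a_def by (simp add: add.assoc)
    moreover have "L_op k u x = (\<Sum>\<^sub>\<infinity>l. k l * a l)"
      unfolding L_op_def a_def by simp
    ultimately have "L_op k u (x + j) - L_op k u x = (\<Sum>\<^sub>\<infinity>l. k l * (a (j + l) - a j - a l))" for j
      by (simp only:) (intro kernel_sum_diff k bd; intro continuous_intros)
    then have "(exp (a j) - 1) * (L_op k u (x + j) - L_op k u x)
        = (\<Sum>\<^sub>\<infinity>l. k l * ((exp (a j) - 1) * (a (j + l) - a j - a l)))" for j
      by (simp add: infsum_cmult_right'[symmetric] ac_simps)
    then show ?thesis
      unfolding B_op_def kernel_sum2_def deriv_Upsilon
      by (simp only: mult.assoc shift) (simp add: a_def)
  qed
  have "bounded2 (\<lambda>j l. exp (a j) * Upsilon (a (j + l) - a j - a l))"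
    by (intro bd continuous_intros contU'; simp)
  then show "bounded2 (\<lambda>j l. exp (u (x + j) - u x) * Upsilon (u (x + j + l) - u (x + j) - u (x + l) + u x))"
    by (simp add: a_def algebra_simps)
  define s where "s j l = a (j + l) - a j - a l" for j l
  define \<phi> where "\<phi> j l = exp (a j) * (exp (s j l) - 1)" for j l
  define \<psi> where "\<psi> j l = exp (a j) * s j l" for j l
  have bd\<phi>: "bounded2 \<phi>"
    unfolding \<phi>_def s_def by (intro bd continuous_intros)
  have bd\<psi>: "bounded2 \<psi>"
    unfolding \<psi>_def s_def by (intro bd continuous_intros)
  have bd\<phi>': "bounded2 (\<lambda>j l. \<phi> l j)"
    using bd\<phi> unfolding bounded2_def bounded_iff by auto
  have bd1: "bounded2 (\<lambda>j l. Upsilon (a (j + l) - a j) - Upsilon (a l))"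
    by (intro bd continuous_intros contU'; simp)
  have bd2: "bounded2 (\<lambda>j l. (exp (a j) - 1) * (a (j + l) - a j - a l))"
    by (intro bd continuous_intros)
  have "2 * Psi2_Upsilon k u x
      = kernel_sum2 k (\<lambda>j l. Upsilon (a (j + l) - a j) - Upsilon (a l) - (exp (a j) - 1) * (a (j + l) - a j - a l))"
    unfolding Psi2_Upsilon_def LPsi B by (simp add: kernel_sum2_diff[OF k bd1 bd2])
  also have "\<dots> = kernel_sum2 k (\<lambda>j l. \<phi> l j - \<psi> j l)"
  proof -
    have "Upsilon (a (j + l) - a j) - Upsilon (a l) - (exp (a j) - 1) * (a (j + l) - a j - a l) = \<phi> l j - \<psi> j l" for j l
    proof -
      have 0: "a (j + l) - a j = s j l + a l" by (simp add: s_def)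
      have 1: "exp (a (j + l) - a j) = exp (a l) * exp (s j l)"
        unfolding s_def by (simp flip: exp_add)
      have 2: "s l j = s j l" unfolding s_def by (simp add: add.commute)
      show ?thesis
        unfolding \<phi>_def \<psi>_def Upsilon_def 1 2 unfolding 0 by (simp add: algebra_simps)
    qed
    then show ?thesis by simp
  qed
  also have "\<dots> = kernel_sum2 k \<phi> - kernel_sum2 k \<psi>"
    by (simp add: kernel_sum2_diff[OF k bd\<phi>' bd\<psi>, symmetric] kernel_sum2_swap[OF k bd\<phi>])
  also have "\<dots> = kernel_sum2 k (\<lambda>j l. exp (a j) * Upsilon (s j l))"
    unfolding kernel_sum2_diff[OF k bd\<phi> bd\<psi>]
    by (simp add: \<phi>_def \<psi>_def Upsilon_def right_diff_distrib)
  finally have "2 * Psi2_Upsilon k u x = kernel_sum2 k (\<lambda>j l. exp (a j) * Upsilon (s j l))" .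
  moreover have "s j l = u (x + j + l) - u (x + j) - u (x + l) + u x" for j l
    by (simp add: s_def a_def add.assoc)
  ultimately show "2 * Psi2_Upsilon k u x = kernel_sum2 k
    (\<lambda>j l. exp (u (x + j) - u x) * Upsilon (u (x + j + l) - u (x + j) - u (x + l) + u x))"
    by (simp only: a_def)
qed

lemma Psi2_Upsilon_ge_finite_sum:
  assumes k: "jump_kernel k" and u: "u \<in> linfty" and "finite J" "\<And>j. j \<in> J \<Longrightarrow> finite (A j)"
  shows "(\<Sum>j\<in>J. k j * (\<Sum>l\<in>A j. k l *
      (exp (u (x + j) - u x) * Upsilon (u (x + j + l) - u (x + j) - u (x + l) + u x))))
    \<le> 2 * Psi2_Upsilon k u x"
proof -
  define h where "h j l = exp (u (x + j) - u x) * Upsilon (u (x + j + l) - u (x + j) - u (x + l) + u x)" for j l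
  have nonneg: "0 \<le> k j" "0 \<le> h j l" for j l
    using k Upsilon_nonneg by (auto simp: jump_kernel_def h_def)
  have bd: "bounded2 h" and eq: "2 * Psi2_Upsilon k u x = kernel_sum2 k h"
    using Psi2_Upsilon_eq_kernel_sum2[OF k u, of x] by (simp_all only: h_def[abs_def])
  have "(\<Sum>j\<in>J. k j * (\<Sum>l\<in>A j. k l * h j l)) \<le> (\<Sum>j\<in>J. k j * (\<Sum>\<^sub>\<infinity>l. k l * h j l))"
    using assms nonneg by (intro sum_mono mult_left_mono finite_sum_le_infsum summable_kernel(2)[OF k bd]) auto
  also have "\<dots> \<le> kernel_sum2 k h"
    unfolding kernel_sum2_def
    using assms nonneg by (intro finite_sum_le_infsum summable_kernel(3)[OF k bd]) (auto intro!: infsum_nonneg mult_nonneg_nonneg)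
  finally show ?thesis by (simp only: eq h_def)
qed

section \<open>Increments of second differences\<close>

definition second_difference :: "(int \<Rightarrow> real) \<Rightarrow> int \<Rightarrow> nat \<Rightarrow> real" where
  "second_difference u x i = (u (x + int i) - u x) + (u (x - int i) - u x)"

lemma kernel_decreasing:
  fixes k :: "int \<Rightarrow> real"
  assumes "antimono_on {1..} k" "1 \<le> i" "i \<le> j"
  shows "k j \<le> k i"
  using monotone_onD[OF assms(1), of i j] assms by simp

lemma kernel_one_pos:
  assumes k: "jump_kernel k" and mono: "antimono_on {1..} k"
  shows "0 < k 1"
proof -
  obtain j where j: "k j \<noteq> 0" "0 \<le> k j" "k 0 = 0" "k (- j) = k j"
    using k unfolding jump_kernel_def by metis
  then have "j \<noteq> 0" by auto
  with j have "k \<bar>j\<bar> = k j" "1 \<le> \<bar>j\<bar>" by (auto simp: abs_if)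
  then show ?thesis using kernel_decreasing[OF mono, of 1 "\<bar>j\<bar>"] j by simp
qed

lemma powr_sum3_le:
  fixes a b c \<gamma> :: real
  assumes "0 \<le> \<gamma>"
  shows "\<bar>a + b + c\<bar> powr \<gamma> \<le> 3 powr \<gamma> * (\<bar>a\<bar> powr \<gamma> + \<bar>b\<bar> powr \<gamma> + \<bar>c\<bar> powr \<gamma>)"
proof -
  define m where "m = max \<bar>a\<bar> (max \<bar>b\<bar> \<bar>c\<bar>)"
  have "\<bar>a + b + c\<bar> powr \<gamma> \<le> (3 * m) powr \<gamma>"
    using assms by (intro powr_mono2) (auto simp: m_def)
  also have "\<dots> = 3 powr \<gamma> * m powr \<gamma>" by (simp add: powr_mult m_def)
  also have "m powr \<gamma> \<le> \<bar>a\<bar> powr \<gamma> + \<bar>b\<bar> powr \<gamma> + \<bar>c\<bar> powr \<gamma>"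
    by (auto simp: m_def max_def)
  finally show ?thesis by simp
qed

lemma sum_int_interval_paired:
  fixes f :: "int \<Rightarrow> real"
  shows "(\<Sum>l\<in>{- int N..int N - 1}. f l) = (\<Sum>i=1..N. f (int i - 1) + f (- int i))"
proof (induction N)
  case (Suc N)
  have "{- int (Suc N)..int (Suc N) - 1} = insert (int N) (insert (- int (Suc N)) {- int N..int N - 1})"
    by auto
  with Suc show ?case by simp
qed simp

text \<open>Only the jumps \<open>\<plusminus>1\<close> are used in the outer sum of the representation of \<open>\<Psi>\<^sub>2\<close>. With
\<open>p = a 1\<close>, \<open>q = a (- 1)\<close> and \<open>z = p + q\<close>, the increment of the second difference from \<open>i - 1\<close> to \<open>i\<close> is
\<open>D + E + z\<close>, where \<open>D\<close> and \<open>E\<close> are the deviations of the steps \<open>i - 1 \<rightarrow> i\<close> and \<open>1 - i \<rightarrow> - i\<close> from the first steps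
\<open>p\<close> and \<open>q\<close>. The four inner jumps \<open>i - 1\<close>, \<open>- i\<close> (after the jump \<open>1\<close>) and \<open>i\<close>, \<open>1 - i\<close> (after the jump \<open>- 1\<close>) contribute
exactly the values \<open>\<Upsilon>(D)\<close>, \<open>\<Upsilon>(- E - z)\<close>, \<open>\<Upsilon>(- D - z)\<close>, \<open>\<Upsilon>(E)\<close> with the weights to which the reflected
pair estimate applies. Monotonicity of the kernel makes their weights at least \<open>k i\<close> when \<open>i \<ge> 2\<close>.\<close>
lemma sum_second_differences_le:
  fixes \<gamma> :: real
  assumes k: "jump_kernel k" and mono: "antimono_on {1..} k" and \<gamma>: "2 \<le> \<gamma>"
  obtains K where "0 < K"
    "\<And>u x N. u \<in> linfty \<Longrightarrow>
      (\<Sum>i=1..N. k (int i) * \<bar>second_difference u x i - second_difference u x (i - 1)\<bar> powr \<gamma>) \<le> K * Psi2_Upsilon k u x"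
proof -
  obtain K where K: "0 < K" "\<And>p q D. \<bar>D\<bar> powr \<gamma> \<le>
    K * (exp p * Upsilon D + exp q * Upsilon (- D - (p + q)) + (exp p + exp q) * Upsilon (- (p + q)))"
    using Upsilon_reflected_powr[OF \<gamma>] by blast
  have nonneg: "0 \<le> k j" for j using k by (auto simp: jump_kernel_def)
  have sym: "k (- j) = k j" for j using k by (auto simp: jump_kernel_def)
  have k0: "k 0 = 0" using k by (auto simp: jump_kernel_def)
  have k_sum: "k summable_on UNIV" using k by (auto simp: jump_kernel_def)
  have k1: "0 < k 1" using kernel_one_pos[OF k mono] .
  define S where "S = infsum k UNIV"
  have S: "0 \<le> S" "(\<Sum>i=1..N. k (int i)) \<le> S" for N
  proof -
    have "(\<Sum>i=1..N. k (int i)) = sum k (int ` {1..N})" by (simp add: sum.reindex)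
    also have "\<dots> \<le> S" unfolding S_def using nonneg by (intro finite_sum_le_infsum k_sum) auto
    finally show "(\<Sum>i=1..N. k (int i)) \<le> S" .
    show "0 \<le> S" unfolding S_def using nonneg by (intro infsum_nonneg)
  qed
  define M where "M = 3 powr \<gamma> * K * (2 / k 1 + 8 * S / (k 1)\<^sup>2)"
  show thesis
  proof
    show "0 < M" unfolding M_def using K S k1 by (intro mult_pos_pos add_pos_nonneg) auto
    fix u x N assume u: "u \<in> linfty"
    define a where "a j = u (x + j) - u x" for j
    define p q z where "p = a 1" and "q = a (- 1)" and "z = p + q"
    define D where "D i = a (int i) - a (int i - 1) - p" for i :: nat
    define E where "E i = a (- int i) - a (1 - int i) - q" for i :: nat
    define R where "R = (exp p + exp q) * Upsilon (- z)"
    define T where "T i = k (int i - 1) * (exp p * Upsilon (D i) + exp q * Upsilon (E i))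
      + k (int i) * (exp q * Upsilon (- D i - z) + exp p * Upsilon (- E i - z))" for i
    have pos: "0 \<le> Upsilon y" for y by (rule Upsilon_nonneg)
    have R: "0 \<le> R" by (simp add: R_def pos)
    have low: "k 1 * (\<Sum>i=1..n. T i) \<le> 2 * Psi2_Upsilon k u x" for n
    proof -
      define h where "h j l = exp (u (x + j) - u x) * Upsilon (u (x + j + l) - u (x + j) - u (x + l) + u x)" for j l
      define I where "I = {- int n..int n - 1}"
      define A where "A j = (if j = 1 then I else uminus ` I)" for j :: int
      have h: "h 1 (int i - 1) = exp p * Upsilon (D i)" "h 1 (- int i) = exp p * Upsilon (- E i - z)"
        "h (- 1) (1 - int i) = exp q * Upsilon (E i)" "h (- 1) (int i) = exp q * Upsilon (- D i - z)" for i
        unfolding h_def D_def E_def z_def p_def q_def a_def by (simp_all add: algebra_simps)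
      have "(\<Sum>j\<in>{1, - 1}. k j * (\<Sum>l\<in>A j. k l * h j l)) \<le> 2 * Psi2_Upsilon k u x"
        unfolding h_def by (intro Psi2_Upsilon_ge_finite_sum k u) (auto simp: A_def I_def)
      also have "(\<Sum>j\<in>{1, - 1}. k j * (\<Sum>l\<in>A j. k l * h j l)) =
        k 1 * ((\<Sum>l\<in>I. k l * h 1 l) + (\<Sum>l\<in>I. k (- l) * h (- 1) (- l)))"
        unfolding A_def by (simp add: sym sum.reindex distrib_left)
      also have "\<dots> = k 1 * (\<Sum>i=1..n. T i)"
        unfolding I_def sum_int_interval_paired sum.distrib[symmetric] T_def
        using sym[of "int i - 1" for i] by (simp add: h sym algebra_simps)
      finally show ?thesis .
    qed
    have T_ge: "k (int i) * (exp p * Upsilon (D i) + exp q * Upsilon (- D i - z)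
      + (exp q * Upsilon (E i) + exp p * Upsilon (- E i - z))) \<le> T i" if "1 \<le> i" for i
    proof -
      have "k (int i) * (exp p * Upsilon (D i) + exp q * Upsilon (E i))
          \<le> k (int i - 1) * (exp p * Upsilon (D i) + exp q * Upsilon (E i))"
      \<comment> \<open>For \<open>i = 1\<close> the weight \<open>k 0\<close> vanishes, but so do both deviations.\<close>
      proof (cases "i = 1")
        case True
        then have "D i = 0" "E i = 0" by (simp_all add: D_def E_def a_def p_def q_def)
        then show ?thesis by (simp add: Upsilon_def)
      next
        case False
        then have "k (int i) \<le> k (int i - 1)" using that by (intro kernel_decreasing[OF mono]) auto
        then show ?thesis by (intro mult_right_mono) (auto simp: pos)
      qed
      then show ?thesis unfolding T_def by (simp add: algebra_simps)
    qed
    have z_le: "\<bar>z\<bar> powr \<gamma> \<le> K * (2 * R)"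
    proof -
      have "\<bar>- z\<bar> powr \<gamma> \<le> K * (exp p * Upsilon (- z) + R)"
        using K(2)[of "- z" p q] by (simp add: z_def R_def Upsilon_def)
      also have "\<dots> \<le> K * (2 * R)" using K pos by (auto simp: R_def algebra_simps)
      finally show ?thesis by simp
    qed
    have b_le: "\<bar>second_difference u x i - second_difference u x (i - 1)\<bar> powr \<gamma> \<le> 3 powr \<gamma> * K *
       (exp p * Upsilon (D i) + exp q * Upsilon (- D i - z) + (exp q * Upsilon (E i) + exp p * Upsilon (- E i - z)) + 4 * R)"
      if "1 \<le> i" for i
    proof -
      have "second_difference u x i - second_difference u x (i - 1) = D i + E i + z"
        using that by (simp add: second_difference_def D_def E_def z_def a_def of_nat_diff algebra_simps)
      then have "\<bar>second_difference u x i - second_difference u x (i - 1)\<bar> powr \<gamma>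
         \<le> 3 powr \<gamma> * (\<bar>D i\<bar> powr \<gamma> + \<bar>E i\<bar> powr \<gamma> + \<bar>z\<bar> powr \<gamma>)"
        using powr_sum3_le[of \<gamma>] \<gamma> by simp
      also have "\<dots> \<le> 3 powr \<gamma> * (K * (exp p * Upsilon (D i) + exp q * Upsilon (- D i - z) + R)
          + K * (exp q * Upsilon (E i) + exp p * Upsilon (- E i - z) + R) + K * (2 * R))"
        using K(2)[of "D i" p q] K(2)[of "E i" q p] z_le
        by (intro mult_left_mono add_mono) (auto simp: z_def R_def add.commute)
      finally show ?thesis by (simp add: algebra_simps)
    qed
    \<comment> \<open>The term \<open>R\<close> occurs in the estimate for every \<open>i\<close>; it is paid for once, by the term with \<open>i = 1\<close>.\<close>
    have k1R: "k 1 * (k 1 * R) \<le> 2 * Psi2_Upsilon k u x"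
    proof -
      have "T 1 = k 1 * R"
        by (simp add: T_def k0 D_def E_def a_def p_def q_def R_def algebra_simps)
      then show ?thesis using low[of 1] by simp
    qed
    have "(\<Sum>i=1..N. k (int i) * \<bar>second_difference u x i - second_difference u x (i - 1)\<bar> powr \<gamma>)
       \<le> (\<Sum>i=1..N. 3 powr \<gamma> * K * (T i + k (int i) * (4 * R)))"
    proof (rule sum_mono)
      fix i assume i: "i \<in> {1..N}"
      define G where "G = exp p * Upsilon (D i) + exp q * Upsilon (- D i - z) + (exp q * Upsilon (E i) + exp p * Upsilon (- E i - z))"
      have "k (int i) * \<bar>second_difference u x i - second_difference u x (i - 1)\<bar> powr \<gamma> \<le> k (int i) * (3 powr \<gamma> * K * (G + 4 * R))"
        using b_le[of i] i nonneg unfolding G_def by (intro mult_left_mono) auto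
      also have "\<dots> = 3 powr \<gamma> * K * (k (int i) * G + k (int i) * (4 * R))" by (simp add: algebra_simps)
      also have "\<dots> \<le> 3 powr \<gamma> * K * (T i + k (int i) * (4 * R))"
        using T_ge[of i] i K(1) unfolding G_def by (intro mult_left_mono add_right_mono) auto
      finally show "k (int i) * \<bar>second_difference u x i - second_difference u x (i - 1)\<bar> powr \<gamma> \<le> \<dots>" .
    qed
    also have "\<dots> = 3 powr \<gamma> * K * ((\<Sum>i=1..N. T i) + (\<Sum>i=1..N. k (int i)) * (4 * R))"
      by (simp only: sum_distrib_right sum.distrib[symmetric] sum_distrib_left)
    also have "\<dots> \<le> 3 powr \<gamma> * K * (2 * Psi2_Upsilon k u x / k 1 + S * (4 * (2 * Psi2_Upsilon k u x / (k 1)\<^sup>2)))"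
      using low[of N] k1R k1 K R S
      by (intro mult_left_mono add_mono mult_mono) (auto simp: field_simps power2_eq_square)
    also have "\<dots> = M * Psi2_Upsilon k u x"
      unfolding M_def by (simp add: algebra_simps)
    finally show "(\<Sum>i=1..N. k (int i) * \<bar>second_difference u x i - second_difference u x (i - 1)\<bar> powr \<gamma>) \<le> M * Psi2_Upsilon k u x" .
  qed
qed

section \<open>Curvature-dimension inequality\<close>

lemma L_op_tendsto:
  assumes k: "jump_kernel k" and u: "u \<in> linfty"
  shows "(\<lambda>N. \<Sum>i=1..N. k (int i) * second_difference u x i) \<longlonglongrightarrow> L_op k u x"
proof -
  define f where "f j = k j * (u (x + j) - u x)" for j
  have nonneg: "0 \<le> k j" and sym: "k (- j) = k j" for j using k by (auto simp: jump_kernel_def)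
  have k_sum: "k summable_on UNIV" using k by (auto simp: jump_kernel_def)
  obtain M where M: "\<bar>u y\<bar> \<le> M" for y
    using u unfolding linfty_def bounded_iff by auto
  have "\<bar>u (x + j) - u x\<bar> \<le> 2 * M" for j
    using M[of "x + j"] M[of x] by linarith
  then have f_le: "norm (f j) \<le> k j * (2 * M)" for j
    unfolding f_def using nonneg by (simp add: abs_mult mult_left_mono)
  have "(\<lambda>j. k j * (2 * M)) summable_on UNIV" using k_sum by (rule summable_on_cmult_left)
  then have "f summable_on UNIV"
    by (rule Infinite_Sum.abs_summable_summable[OF Infinite_Sum.abs_summable_on_comparison_test'[OF _ f_le]])
  then have "(f has_sum L_op k u x) UNIV"
    using has_sum_infsum[of f UNIV] by (simp only: L_op_def f_def[abs_def])
  then have "(sum f \<longlongrightarrow> L_op k u x) (finite_subsets_at_top UNIV)"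
    unfolding has_sum_def .
  moreover have "filterlim (\<lambda>N. {- int N..int N}) (finite_subsets_at_top UNIV) sequentially"
    unfolding filterlim_finite_subsets_at_top
  proof (intro allI impI)
    fix X :: "int set" assume X: "finite X \<and> X \<subseteq> UNIV"
    have "X \<subseteq> {- int N..int N}" if "nat (\<Sum>j\<in>X. \<bar>j\<bar>) \<le> N" for N
    proof
      fix j assume "j \<in> X"
      then have "\<bar>j\<bar> \<le> (\<Sum>j\<in>X. \<bar>j\<bar>)" using X by (intro member_le_sum) auto
      then show "j \<in> {- int N..int N}" using that by auto
    qed
    then show "\<forall>\<^sub>F N in sequentially. finite {- int N..int N} \<and> X \<subseteq> {- int N..int N} \<and> {- int N..int N} \<subseteq> UNIV"
      by (auto intro!: eventually_sequentiallyI)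
  qed
  ultimately have "(\<lambda>N. sum f {- int N..int N}) \<longlonglongrightarrow> L_op k u x"
    by (rule filterlim_compose)
  moreover have "sum f {- int N..int N} = (\<Sum>i=1..N. k (int i) * second_difference u x i)" for N
  proof (induction N)
    case (Suc N)
    have "{- int (Suc N)..int (Suc N)} = insert (int (Suc N)) (insert (- int (Suc N)) {- int N..int N})"
      by auto
    with Suc show ?case
      using sym[of "int (Suc N)"] by (simp add: f_def second_difference_def algebra_simps)
  qed (simp add: f_def)
  ultimately show ?thesis by simp
qed

text \<open>Partial sums of \<open>L u x\<close> are sums of telescoped second differences, so the estimate of their increments and
Hardy's inequality bound them uniformly.\<close>
lemma Psi2_Upsilon_ge_L_op_powr:
  fixes k :: "int \<Rightarrow> real" and \<alpha> \<gamma> :: real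
  assumes \<alpha>: "1 < \<alpha>" "\<alpha> \<le> 2" and \<gamma>: "\<gamma> = \<alpha> / (\<alpha> - 1)" and k: "jump_kernel k"
    and moment: "(\<lambda>j. k j * real_of_int j powr \<alpha>) summable_on {1..}"
    and mono: "antimono_on {1..} k"
  obtains d where "0 < d" "\<And>u x. u \<in> linfty \<Longrightarrow> 1 / d * \<bar>L_op k u x\<bar> powr \<gamma> \<le> Psi2_Upsilon k u x"
proof -
  have nonneg: "0 \<le> k j" for j using k by (auto simp: jump_kernel_def)
  have \<gamma>2: "2 \<le> \<gamma>" using \<alpha> by (simp add: \<gamma> field_simps)
  obtain K where K: "0 < K" "\<And>u x N. u \<in> linfty \<Longrightarrow>
      (\<Sum>i=1..N. k (int i) * \<bar>second_difference u x i - second_difference u x (i - 1)\<bar> powr \<gamma>) \<le> K * Psi2_Upsilon k u x"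
    using sum_second_differences_le[OF k mono \<gamma>2] by blast
  define m where "m = (\<Sum>\<^sub>\<infinity>j\<in>{1..}. k j * real_of_int j powr \<alpha>)"
  have m: "(\<Sum>j=1..N. k (int j) * real j powr \<alpha>) \<le> m" for N
  proof -
    have "(\<Sum>j=1..N. k (int j) * real j powr \<alpha>) = (\<Sum>j\<in>int ` {1..N}. k j * real_of_int j powr \<alpha>)"
      by (simp add: sum.reindex)
    also have "\<dots> \<le> m"
      unfolding m_def using nonneg by (intro finite_sum_le_infsum moment) auto
    finally show ?thesis .
  qed
  have "0 < k 1" using kernel_one_pos[OF k mono] .
  then have m_pos: "0 < m" using m[of 1] by simp
  define d where "d = (2 * m) powr (\<gamma> - 1) * (3 * K)"
  have d: "0 < d" using m_pos K by (simp add: d_def)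
  show thesis
  proof (rule that[OF d])
    fix u x assume u: "u \<in> linfty"
    define z where "z = second_difference u x"
    define b where "b i = \<bar>z i - z (i - 1)\<bar>" for i
    have bound: "\<bar>\<Sum>j=1..N. k (int j) * z j\<bar> powr \<gamma> \<le> d * Psi2_Upsilon k u x" for N
    proof -
      have z_le: "\<bar>z j\<bar> \<le> (\<Sum>i=1..j. b i)" for j
      proof (induction j)
        case (Suc j)
        then show ?case by (simp add: b_def)
      qed (simp add: z_def second_difference_def)
      have "\<bar>\<Sum>j=1..N. k (int j) * z j\<bar> \<le> (\<Sum>j=1..N. \<bar>k (int j) * z j\<bar>)"
        by (rule sum_abs)
      also have "\<dots> \<le> (\<Sum>j=1..N. k (int j) * (\<Sum>i=1..j. b i))"
        using nonneg z_le by (intro sum_mono) (simp add: abs_mult mult_left_mono)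
      finally have "\<bar>\<Sum>j=1..N. k (int j) * z j\<bar> powr \<gamma> \<le> (\<Sum>j=1..N. k (int j) * (\<Sum>i=1..j. b i)) powr \<gamma>"
        using \<gamma>2 by (intro powr_mono2) auto
      also have "\<dots> \<le> (2 * (\<Sum>j=1..N. k (int j) * real j powr \<alpha>)) powr (\<gamma> - 1)
          * (3 * (\<Sum>i=1..N. k (int i) * b i powr \<gamma>))"
        using nonneg kernel_decreasing[OF mono]
        by (intro discrete_Hardy[OF \<alpha> \<gamma>]) (auto simp: b_def)
      also have "\<dots> \<le> (2 * m) powr (\<gamma> - 1) * (3 * (K * Psi2_Upsilon k u x))"
        using m K(2)[OF u, of x N] nonneg \<gamma>2
        by (intro mult_mono powr_mono2) (auto intro!: sum_nonneg mult_nonneg_nonneg simp: b_def z_def)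
      also have "\<dots> = d * Psi2_Upsilon k u x" by (simp add: d_def)
      finally show ?thesis .
    qed
    have "(\<lambda>N. \<bar>\<Sum>j=1..N. k (int j) * z j\<bar> powr \<gamma>) \<longlonglongrightarrow> \<bar>L_op k u x\<bar> powr \<gamma>"
      unfolding z_def using \<gamma>2
      by (intro tendsto_powr' tendsto_rabs L_op_tendsto[OF k u] tendsto_const) auto
    then have "\<bar>L_op k u x\<bar> powr \<gamma> \<le> d * Psi2_Upsilon k u x"
      by (rule LIMSEQ_le_const2) (use bound in auto)
    then show "1 / d * \<bar>L_op k u x\<bar> powr \<gamma> \<le> Psi2_Upsilon k u x"
      using d by (simp add: field_simps)
  qed
qed

lemma CD_function_powr:
  fixes c \<gamma> :: real
  assumes "0 < c" "1 < \<gamma>"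
  shows "CD_function (\<lambda>r. c * r powr \<gamma>)"
  unfolding CD_function_def
proof (intro conjI)
  show "continuous_on {0..} (\<lambda>r. c * r powr \<gamma>)"
    using assms by (intro continuous_intros continuous_on_powr') auto
  show "strict_mono_on {0<..} (\<lambda>r. c * r powr \<gamma> / r)"
  proof (rule strict_mono_onI)
    fix r s :: real assume rs: "r \<in> {0<..}" "s \<in> {0<..}" "r < s"
    have *: "c * v powr \<gamma> / v = c * v powr (\<gamma> - 1)" if "0 < v" for v
      using that by (simp add: powr_diff)
    show "c * r powr \<gamma> / r < c * s powr \<gamma> / s"
      using rs assms powr_less_mono2[of "\<gamma> - 1" r s] by (simp add: *)
  qed
  have "set_integrable lborel {1..} (\<lambda>r. r powr - \<gamma>)"
  proof -
    have "(\<lambda>r. r powr - \<gamma>) integrable_on {1..}"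
      using has_integral_powr_to_inf[of "- \<gamma>" 1] assms by (auto simp: integrable_on_def)
    then have "(\<lambda>r. r powr - \<gamma>) absolutely_integrable_on {1..}"
      by (intro nonnegative_absolutely_integrable_1) auto
    then show ?thesis
      unfolding set_integrable_def by (subst (asm) integrable_completion) simp_all
  qed
  then have "set_integrable lborel {1..} (\<lambda>r. 1 / c * r powr - \<gamma>)"
    by simp
  then have "set_integrable lborel {1..} (\<lambda>r. 1 / (c * r powr \<gamma>))"
    by (simp add: powr_minus_divide)
  then show "\<exists>R>0. set_integrable lborel {R..} (\<lambda>r. 1 / (c * r powr \<gamma>))"
    by (intro exI[of _ 1]) simp
qed (use assms in auto)

theorem theorem4p2:
  fixes k :: "int \<Rightarrow> real" and \<alpha> \<gamma> C :: real
  assumes alpha: "1 < \<alpha>" "\<alpha> \<le> 2"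
    and gamma: "\<gamma> = \<alpha> / (\<alpha> - 1)"
    and kernel: "jump_kernel k"
    and moment: "(\<lambda>j. k j * real_of_int j powr \<alpha>) summable_on {1..}"
    and nonincreasing: "antimono_on {1..} k"
    and C: "C \<ge> 1" "\<forall>j\<ge>1. k j \<le> C * k (j + 1)"
  shows "\<exists>d>0.
    (\<forall>x. \<forall>u\<in>linfty. Psi2_Upsilon k u x \<ge> 1 / d * \<bar>L_op k u x\<bar> powr \<gamma>) \<and>
    CD_function (\<lambda>r. 1 / d * r powr \<gamma>) \<and>
    CD_Upsilon_0 k (\<lambda>r. 1 / d * r powr \<gamma>)"
proof -
  obtain d where d: "0 < d"
    and main: "\<And>u x. u \<in> linfty \<Longrightarrow> 1 / d * \<bar>L_op k u x\<bar> powr \<gamma> \<le> Psi2_Upsilon k u x"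
    using Psi2_Upsilon_ge_L_op_powr[OF alpha gamma kernel moment nonincreasing] by blast
  have "1 < \<gamma>" using alpha by (simp add: gamma field_simps)
  then have "CD_function (\<lambda>r. 1 / d * r powr \<gamma>)"
    using d by (intro CD_function_powr) auto
  moreover have "CD_Upsilon_0 k (\<lambda>r. 1 / d * r powr \<gamma>)"
    unfolding CD_Upsilon_0_def
  proof (intro ballI allI)
    fix u x assume u: "u \<in> linfty"
    have "0 \<le> 1 / d * \<bar>L_op k u x\<bar> powr \<gamma>" using d by simp
    then show "if 0 \<le> - L_op k u x then 1 / d * (- L_op k u x) powr \<gamma> \<le> Psi2_Upsilon k u x
        else 0 \<le> Psi2_Upsilon k u x"
      using main[OF u, of x] by (auto simp: abs_if split: if_splits)
  qed
  ultimately show ?thesis using d main by blast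
qed

end
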